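(* The family of the laws of $P_1(\theta)$, $\theta>0$, satisfies a large deviation principle on $[0,1]$ (as $\theta\to\infty$) with speed $\theta$ and rate function $$I(x)=\begin{cases}\log\dfrac1{1-x}, & x\in[0,1),\\ \infty, & \text{else.}\end{cases}$$
   Context: **Large deviation principle (LDP).** Let $E$ be a complete separable metric space. A family $\{Q_\theta:\theta>0\}$ of probability measures on $E$ satisfies an LDP (as $\theta\to\infty$) with speed $\theta$ and rate function $I:E\to[0,\infty]$ if for every closed $F\subset E$ and every open $G\subset E$, $\limsup_{\theta\to\infty}\frac1\theta\log Q_\theta\{F\}\le-\inf_{x\in F}I(x)$ and $\liminf_{\theta\to\infty}\frac1\theta\log Q_\theta\{G\}\ge-\inf_{x\in G}I(x)$, and for every $c>0$ the set $\{x:I(x)\le c\}$ is compact. (Conventions: $\log 0=-\infty$, $\inf\emptyset=\infty$.) **The Poisson–Dirichlet distribution.** For $\theta>0$, let $U_1,U_2,\ldots$ be i.i.d. with $Beta(1,\theta)$ distribution (density $\theta(1-x)^{\theta-1}$ on $(0,1)$). Put $X_1=U_1$ and $X_k=(1-U_1)\cdots(1-U_{k-1})U_k$ for $k\ge2$. Let $P_k(\theta)$ be the $k$th largest among $X_1,X_2,\ldots$, so $P_1(\theta)=\max_{k\ge1}X_k$. The law of $(P_1(\theta),P_2(\theta),\ldots)$ is the Poisson–Dirichlet distribution $PD(\theta)$. *)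

theory Defs
  imports "HOL-Probability.Probability"
begin

text \<open>Logarithm on [0, \<infinity>) with log 0 = -\<infinity>.\<close>

definition log_ereal :: "real \<Rightarrow> ereal" where
  "log_ereal p = (if p = 0 then - \<infinity> else ereal (ln p))"

text \<open>
  The complete separable metric space is a complete subset \<^term>\<open>E\<close> of a second countable metric
  type, with the induced topology and Borel sigma-algebra. The infimum over the empty set is
  \<^term>\<open>\<infinity> :: ereal\<close>, the top element.
\<close>

definition satisfies_LDP ::
  "'a::{metric_space, second_countable_topology} set \<Rightarrow> (real \<Rightarrow> 'a measure) \<Rightarrow> ('a \<Rightarrow> ereal) \<Rightarrow> bool"
where
  "satisfies_LDP E Q I \<longleftrightarrow>
     uniform_space_class.complete E \<and>
     (\<forall>\<theta>>0. prob_space (Q \<theta>) \<and> sets (Q \<theta>) = sets (restrict_space borel E)) \<and>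
     (\<forall>x\<in>E. 0 \<le> I x) \<and>
     (\<forall>F. closedin (top_of_set E) F \<longrightarrow>
        Limsup at_top (\<lambda>\<theta>. ereal (1 / \<theta>) * log_ereal (measure (Q \<theta>) F)) \<le> - (INF x\<in>F. I x)) \<and>
     (\<forall>G. openin (top_of_set E) G \<longrightarrow>
        - (INF x\<in>G. I x) \<le> Liminf at_top (\<lambda>\<theta>. ereal (1 / \<theta>) * log_ereal (measure (Q \<theta>) G))) \<and>
     (\<forall>c::real. c > 0 \<longrightarrow> compact {x \<in> E. I x \<le> ereal c})"

definition beta_1_density :: "real \<Rightarrow> real \<Rightarrow> real" where
  "beta_1_density \<theta> x = (if 0 < x \<and> x < 1 then \<theta> * (1 - x) powr (\<theta> - 1) else 0)"

text \<open>Indices are shifted by one: \<^term>\<open>stick_breaking u k\<close> is the stick \<open>X\<close> with index \<open>k + 1\<close>.\<close>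

definition stick_breaking :: "(nat \<Rightarrow> real) \<Rightarrow> nat \<Rightarrow> real" where
  "stick_breaking u k = (\<Prod>j<k. 1 - u j) * u k"

text \<open>
  The \<open>k\<close>th largest term (\<open>k \<ge> 1\<close>), counted with multiplicity; it need not exist for an arbitrary
  sequence. The finiteness conditions are needed because \<^const>\<open>card\<close> is 0 on infinite sets.
\<close>

definition is_kth_largest :: "nat \<Rightarrow> (nat \<Rightarrow> real) \<Rightarrow> real \<Rightarrow> bool" where
  "is_kth_largest k x v \<longleftrightarrow>
     v \<in> range x \<and>
     finite {i. v < x i} \<and> card {i. v < x i} < k \<and>
     (finite {i. v \<le> x i} \<longrightarrow> k \<le> card {i. v \<le> x i})"

definition kth_largest :: "nat \<Rightarrow> (nat \<Rightarrow> real) \<Rightarrow> real" where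
  "kth_largest k x = (THE v. is_kth_largest k x v)"

lemma is_kth_largest_unique:
  assumes "is_kth_largest k x v" "is_kth_largest k x w"
  shows "v = w"
proof -
  have False if "is_kth_largest k x a" "is_kth_largest k x b" "a < b" for a b
  proof -
    have sub: "{i. b \<le> x i} \<subseteq> {i. a < x i}"
      using that(3) by auto
    have fin: "finite {i. a < x i}"
      using that(1) by (simp add: is_kth_largest_def)
    have "k \<le> card {i. b \<le> x i}"
      using that(2) finite_subset[OF sub fin] by (simp add: is_kth_largest_def)
    also have "\<dots> \<le> card {i. a < x i}"
      by (rule card_mono[OF fin sub])
    also have "\<dots> < k"
      using that(1) by (simp add: is_kth_largest_def)
    finally show False by simp
  qed
  with assms show ?thesis
    by (meson linorder_neqE)
qed

lemma kth_largest_eqI: "is_kth_largest k x v \<Longrightarrow> kth_largest k x = v"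
  unfolding kth_largest_def by (blast intro: the_equality is_kth_largest_unique)

lemma is_kth_largest_1_iff: "is_kth_largest 1 x v \<longleftrightarrow> v \<in> range x \<and> (\<forall>i. x i \<le> v)"
proof
  assume "is_kth_largest 1 x v"
  then show "v \<in> range x \<and> (\<forall>i. x i \<le> v)"
    by (auto simp: is_kth_largest_def not_less[symmetric])
next
  assume *: "v \<in> range x \<and> (\<forall>i. x i \<le> v)"
  then have "{i. v < x i} = {}" "{i. v \<le> x i} \<noteq> {}"
    by (auto simp: not_less)
  with * show "is_kth_largest 1 x v"
    by (auto simp: is_kth_largest_def Suc_le_eq card_gt_0_iff)
qed

text \<open>
  \<open>P\<^sub>k(\<theta>)\<close> on a sample space carrying the Beta variables \<^term>\<open>U :: nat \<Rightarrow> 'w \<Rightarrow> real\<close>; the law of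
  the sequence over \<open>k \<ge> 1\<close> is \<open>PD(\<theta>)\<close>.
\<close>

definition PD_component :: "(nat \<Rightarrow> 'w \<Rightarrow> real) \<Rightarrow> nat \<Rightarrow> 'w \<Rightarrow> real" where
  "PD_component U k \<omega> = kth_largest k (stick_breaking (\<lambda>i. U i \<omega>))"

text \<open>
  The law, as a measure on [0, 1], of a real random variable whose values lie in [0, 1] almost surely.
\<close>

definition law_on_unit_interval :: "'w measure \<Rightarrow> ('w \<Rightarrow> real) \<Rightarrow> real measure" where
  "law_on_unit_interval M X = restrict_space (distr M borel X) {0..1}"

end

theory Submission
  imports Defs "HOL-Real_Asymp.Real_Asymp"
begin

text \<open>
  The whole argument rests on a two-sided bound for the tail of \<open>P\<^sub>1 = P\<^sub>1(\<theta>)\<close>: for \<open>0 < x \<le> 1\<close>,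
  \<open>(1 - x)\<^sup>\<theta> \<le> P(P\<^sub>1 \<ge> x) \<le> (\<theta> + 1) / x \<sqdot> (1 - x)\<^sup>\<theta>\<close>.
  On the exponential scale the two sides agree, and their common rate is \<open>log (1 / (1 - x))\<close>.

  The lower bound holds because \<open>P\<^sub>1\<close> is at least the first stick, which is itself
  a beta variable. For the upper bound, some stick must be at least \<open>x\<close>, so a union
  bound applies. If the stick \<open>U\<^sub>k \<Prod>\<^bsub>j<k\<^esub> (1 - U\<^sub>j)\<close> is at least \<open>x\<close>, then so are both \<open>U\<^sub>k\<close> and the
  product. By Markov's inequality and independence this has probability at most
  \<open>(1 - x)\<^sup>\<theta> / x \<sqdot> (\<theta> / (\<theta> + 1))\<^sup>k\<close>, and the geometric series sums to the stated bound
  (lemmas \<open>prob_stick_ge\<close> and \<open>prob_P1_ge_upper\<close>).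

  The rate function is increasing, which turns these tail bounds into the large deviation principle.
  A closed set lies to the right of its minimum, where the rate function attains its infimum over
  the set. An open set that contains \<open>x < 1\<close> contains some \<open>[x, b)\<close> with \<open>b > x\<close>, and
  \<open>P(x \<le> P\<^sub>1 < b)\<close> is at least \<open>(1 - x)\<^sup>\<theta>\<close> minus the tail bound at \<open>b\<close>, which is of smaller
  exponential order.
\<close>

section \<open>The largest term of a sequence\<close>

(* Otherwise the simplifier turns the rank 1 into Suc 0, and facts about rank 1 no longer match. *)
declare One_nat_def [simp del]

lemma kth_largest_1_eq:
  assumes "\<And>i. x i \<le> x n"
  shows "kth_largest 1 x = x n"
  using assms by (intro kth_largest_eqI) (auto simp: is_kth_largest_1_iff)

text \<open>
  Without a maximum, the description of the largest term is unsatisfiable. The value is then the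
  same unspecified number for all such sequences, so it does not spoil measurability.
\<close>

lemma kth_largest_1_of_no_max:
  assumes "\<nexists>n. \<forall>i. x i \<le> x n"
  shows "kth_largest 1 x = (THE v. False)"
proof -
  have "is_kth_largest 1 x v \<longleftrightarrow> False" for v
    using assms by (auto simp: is_kth_largest_1_iff)
  then show ?thesis
    by (simp add: kth_largest_def)
qed

text \<open>
  Measurability is needed on the whole sample space, not just almost everywhere, for the
  image measure of the largest stick to be meaningful. The maximum, where it exists, is read off at
  the least index that attains it, which is a measurable function of the sample point.
\<close>

lemma borel_measurable_kth_largest_1:
  assumes [measurable]: "\<And>i. X i \<in> borel_measurable M"
  shows "(\<lambda>\<omega>. kth_largest 1 (\<lambda>i. X i \<omega>)) \<in> borel_measurable M"
proof -
  define N where "N \<omega> = (LEAST n. \<forall>i. X i \<omega> \<le> X n \<omega>)" for \<omega>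
  have [measurable]: "N \<in> measurable M (count_space UNIV)"
    unfolding N_def by measurable
  have "kth_largest 1 (\<lambda>i. X i \<omega>) =
      (if \<exists>n. \<forall>i. X i \<omega> \<le> X n \<omega> then X (N \<omega>) \<omega> else (THE v. False))" for \<omega>
  proof (cases "\<exists>n. \<forall>i. X i \<omega> \<le> X n \<omega>")
    case True
    then have "\<forall>i. X i \<omega> \<le> X (N \<omega>) \<omega>"
      unfolding N_def by (rule LeastI_ex)
    then have "kth_largest 1 (\<lambda>i. X i \<omega>) = X (N \<omega>) \<omega>"
      by (intro kth_largest_1_eq) blast
    with True show ?thesis by simp
  next
    case False
    then show ?thesis by (subst kth_largest_1_of_no_max) auto
  qed
  moreover have "(\<lambda>\<omega>. X (N \<omega>) \<omega>) \<in> borel_measurable M"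
    by (rule measurable_compose_countable) measurable
  ultimately show ?thesis
    by simp
qed

lemma null_sequence_attains_max:
  fixes x :: "nat \<Rightarrow> real"
  assumes "x \<longlonglongrightarrow> 0" "x 0 > 0"
  shows "\<exists>n. \<forall>i. x i \<le> x n"
proof -
  from order_tendstoD(2)[OF assms] obtain N where N: "\<And>i. i \<ge> N \<Longrightarrow> x i < x 0"
    by (auto simp: eventually_sequentially)
  have "Max (x ` {..N}) \<in> x ` {..N}"
    by (rule Max_in) auto
  then obtain n where n: "Max (x ` {..N}) = x n"
    by blast
  have le: "x i \<le> x n" if "i \<le> N" for i
    unfolding n[symmetric] using that by (intro Max_ge) auto
  have "x i \<le> x n" for i
    using le[of i] le[of 0] N[of i] by (cases "i \<le> N") auto
  then show ?thesis by blast
qed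

section \<open>Stick breaking\<close>

text \<open>
  The sticks broken off so far and the remaining piece add up to one. Hence the sticks are summable
  and tend to zero, which is why a largest one exists.
\<close>

lemma sum_stick_breaking: "(\<Sum>k<n. stick_breaking u k) = 1 - (\<Prod>k<n. 1 - u k)"
  by (induction n) (simp_all add: stick_breaking_def algebra_simps)

context
  fixes u :: "nat \<Rightarrow> real"
  assumes u: "\<And>i. 0 < u i" "\<And>i. u i < 1"
begin

lemma stick_breaking_pos: "0 < stick_breaking u k"
  unfolding stick_breaking_def by (intro mult_pos_pos prod_pos) (auto simp: u)

lemma stick_breaking_le_factors:
  shows "stick_breaking u k \<le> u k" "stick_breaking u k \<le> (\<Prod>j<k. 1 - u j)"
proof -
  have "0 \<le> (\<Prod>j<k. 1 - u j)" "(\<Prod>j<k. 1 - u j) \<le> 1"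
    by (auto intro!: prod_nonneg prod_le_1 simp: u less_imp_le)
  then show "stick_breaking u k \<le> u k" "stick_breaking u k \<le> (\<Prod>j<k. 1 - u j)"
    unfolding stick_breaking_def
    by (auto intro!: mult_left_le_one_le mult_left_le simp: u less_imp_le)
qed

lemma stick_breaking_tendsto_0: "stick_breaking u \<longlonglongrightarrow> 0"
proof -
  have "(\<Sum>k<n. stick_breaking u k) \<le> 1" for n
    unfolding sum_stick_breaking by (auto intro!: prod_nonneg simp: u less_imp_le)
  then have "summable (stick_breaking u)"
    by (intro summableI_nonneg_bounded[where x = 1]) (auto intro: less_imp_le stick_breaking_pos)
  then show ?thesis by (rule summable_LIMSEQ_zero)
qed

lemma largest_stick:
  obtains n where "kth_largest 1 (stick_breaking u) = stick_breaking u n"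
    "\<And>i. stick_breaking u i \<le> kth_largest 1 (stick_breaking u)"
proof -
  from null_sequence_attains_max[OF stick_breaking_tendsto_0 stick_breaking_pos]
  obtain n where n: "\<And>i. stick_breaking u i \<le> stick_breaking u n" by blast
  from that[of n] n kth_largest_1_eq[of "stick_breaking u" n] show thesis by metis
qed

end

section \<open>Integrals of the beta density\<close>

text \<open>
  The exponent \<^term>\<open>s = \<theta>\<close> gives the tail of the beta distribution, and \<^term>\<open>s = \<theta> + 1\<close>
  the mean of \<open>1 - U\<close>. For \<open>s < 1\<close> the integrand is unbounded at \<open>1\<close>, so the fundamental theorem is
  used in the form that asks for continuity of the antiderivative on the closed interval and for the
  derivative only inside it.
\<close>

lemma nn_integral_one_minus_powr:
  fixes s x :: real
  assumes "s > 0" "0 \<le> x" "x \<le> 1"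
  shows "(\<integral>\<^sup>+t. ennreal (indicator {x<..<1} t * (1 - t) powr (s - 1)) \<partial>lborel)
           = ennreal ((1 - x) powr s / s)"
proof -
  let ?F = "\<lambda>t. - ((1 - t) powr s / s)"
  have "((\<lambda>t. (1 - t) powr (s - 1)) has_integral (?F 1 - ?F x)) {x..1}"
  proof (rule fundamental_theorem_of_calculus_interior)
    show "continuous_on {x..1} ?F"
      using assms by (auto intro!: continuous_intros continuous_on_powr')
    fix t assume t: "t \<in> {x<..<1}"
    show "(?F has_vector_derivative (1 - t) powr (s - 1)) (at t)"
      unfolding has_real_derivative_iff_has_vector_derivative[symmetric]
      using t assms by (auto intro!: derivative_eq_intros simp: field_simps powr_diff)
  qed fact
  then have "((\<lambda>t. (1 - t) powr (s - 1)) has_integral ((1 - x) powr s / s)) {x<..<1}"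
    using assms by (simp add: has_integral_Icc_iff_Ioo)
  then have "((\<lambda>t. indicator {x<..<1} t * (1 - t) powr (s - 1)) has_integral ((1 - x) powr s / s)) UNIV"
    by (subst (asm) has_integral_restrict_UNIV[symmetric])
       (auto elim!: has_integral_eq[rotated] simp: indicator_def)
  then show ?thesis
    by (intro nn_integral_has_integral_lborel) auto
qed

section \<open>Tail bounds for the largest stick\<close>

locale iid_beta = prob_space M for M :: "'w measure" +
  fixes \<theta> :: real and U :: "nat \<Rightarrow> 'w \<Rightarrow> real"
  assumes theta_pos: "\<theta> > 0"
    and indep_U: "indep_vars (\<lambda>_. borel) U UNIV"
    and distributed_U: "\<And>i. distributed M lborel (U i) (\<lambda>x. ennreal (beta_1_density \<theta> x))"
begin

abbreviation "P1 \<equiv> PD_component U 1"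

lemma random_variable_U [measurable]: "U i \<in> borel_measurable M"
  using distributed_measurable[OF distributed_U] by simp

lemma random_variable_P1 [measurable]: "P1 \<in> borel_measurable M"
proof -
  have [measurable]: "(\<lambda>\<omega>. stick_breaking (\<lambda>i. U i \<omega>) k) \<in> borel_measurable M" for k
    unfolding stick_breaking_def by measurable
  show ?thesis
    unfolding PD_component_def by (rule borel_measurable_kth_largest_1) measurable
qed

lemma AE_U_in_unit_interval: "AE \<omega> in M. \<forall>i. 0 < U i \<omega> \<and> U i \<omega> < 1"
proof -
  have "AE \<omega> in M. 0 < U i \<omega> \<and> U i \<omega> < 1" for i
    by (subst distributed_AE2[OF distributed_U]) (auto simp: beta_1_density_def)
  then show ?thesis by (simp add: AE_all_countable)
qed

lemma nn_integral_one_minus_U: "(\<integral>\<^sup>+\<omega>. ennreal (1 - U i \<omega>) \<partial>M) = ennreal (\<theta> / (\<theta> + 1))"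
proof -
  have "(\<integral>\<^sup>+\<omega>. ennreal (1 - U i \<omega>) \<partial>M) =
      (\<integral>\<^sup>+t. ennreal (beta_1_density \<theta> t) * ennreal (1 - t) \<partial>lborel)"
    by (rule distributed_nn_integral[OF distributed_U, symmetric]) simp
  also have "\<dots> = (\<integral>\<^sup>+t. ennreal \<theta> * ennreal (indicator {0<..<1} t * (1 - t) powr (\<theta> + 1 - 1)) \<partial>lborel)"
    using theta_pos
    by (intro nn_integral_cong)
       (auto simp: beta_1_density_def powr_diff indicator_def ennreal_mult[symmetric])
  also have "\<dots> = ennreal \<theta> * (\<integral>\<^sup>+t. ennreal (indicator {0<..<1} t * (1 - t) powr (\<theta> + 1 - 1)) \<partial>lborel)"
    by (rule nn_integral_cmult) simp
  also have "\<dots> = ennreal \<theta> * ennreal (1 / (\<theta> + 1))"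
    using theta_pos by (subst nn_integral_one_minus_powr) auto
  also have "\<dots> = ennreal (\<theta> / (\<theta> + 1))"
    using theta_pos by (simp add: ennreal_mult[symmetric])
  finally show ?thesis .
qed

lemma nn_integral_U_ge:
  assumes "0 \<le> x" "x \<le> 1"
  shows "(\<integral>\<^sup>+\<omega>. indicator {x..} (U i \<omega>) \<partial>M) = ennreal ((1 - x) powr \<theta>)"
proof -
  have "(\<integral>\<^sup>+\<omega>. indicator {x..} (U i \<omega>) \<partial>M) =
      (\<integral>\<^sup>+t. ennreal (beta_1_density \<theta> t) * indicator {x..} t \<partial>lborel)"
    by (rule distributed_nn_integral[OF distributed_U, symmetric]) simp
  also have "\<dots> = (\<integral>\<^sup>+t. ennreal \<theta> * ennreal (indicator {x<..<1} t * (1 - t) powr (\<theta> - 1)) \<partial>lborel)"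
    using AE_lborel_singleton[of x] theta_pos assms
    by (auto intro!: nn_integral_cong_AE elim!: eventually_mono
        simp: beta_1_density_def indicator_def ennreal_mult[symmetric])
  also have "\<dots> = ennreal \<theta> * (\<integral>\<^sup>+t. ennreal (indicator {x<..<1} t * (1 - t) powr (\<theta> - 1)) \<partial>lborel)"
    by (rule nn_integral_cmult) simp
  also have "\<dots> = ennreal ((1 - x) powr \<theta>)"
    using theta_pos assms by (subst nn_integral_one_minus_powr) (auto simp: ennreal_mult[symmetric])
  finally show ?thesis .
qed

lemma prob_U_ge:
  assumes "0 \<le> x" "x \<le> 1"
  shows "prob {\<omega> \<in> space M. x \<le> U i \<omega>} = (1 - x) powr \<theta>"
proof -
  have "(\<integral>\<^sup>+\<omega>. indicator {x..} (U i \<omega>) \<partial>M) = (\<integral>\<^sup>+\<omega>. indicator {\<omega> \<in> space M. x \<le> U i \<omega>} \<omega> \<partial>M)"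
    by (intro nn_integral_cong) (auto simp: indicator_def)
  then have "emeasure M {\<omega> \<in> space M. x \<le> U i \<omega>} = ennreal ((1 - x) powr \<theta>)"
    using nn_integral_U_ge[OF assms] by simp
  then show ?thesis by (simp add: measure_def)
qed

text \<open>
  Since \<open>x \<le> \<Prod>\<^bsub>j<k\<^esub> (1 - U\<^sub>j)\<close> and \<open>x \<le> U\<^sub>k\<close> on this event, its indicator is at most
  \<open>(1 / x) \<Prod>\<^bsub>j<k\<^esub> (1 - U\<^sub>j) \<sqdot> 1{U\<^sub>k \<ge> x}\<close>, a product of functions of the single independent
  variables. Keeping both factors matters: the indicator produces the exponential rate,
  the product the decay in \<open>k\<close> that makes the union bound over all sticks converge.
\<close>

lemma prob_stick_ge:
  assumes "0 < x" "x \<le> 1"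
  shows "prob {\<omega> \<in> space M. x \<le> stick_breaking (\<lambda>i. U i \<omega>) k}
           \<le> (1 - x) powr \<theta> / x * (\<theta> / (\<theta> + 1)) ^ k"
proof -
  define Y :: "nat \<Rightarrow> real \<Rightarrow> ennreal" where
    "Y j t = (if j < k then ennreal (1 - t) else indicator {x..} t)" for j t
  have [measurable]: "Y j \<in> borel_measurable borel" for j
    unfolding Y_def by (cases "j < k") simp_all
  have stick: "(\<lambda>\<omega>. stick_breaking (\<lambda>i. U i \<omega>) k) \<in> borel_measurable M"
    unfolding stick_breaking_def by measurable
  have "emeasure M {\<omega> \<in> space M. x \<le> stick_breaking (\<lambda>i. U i \<omega>) k}
      \<le> emeasure M {\<omega> \<in> space M. 1 \<le> ennreal (1 / x) * (\<Prod>j\<le>k. Y j (U j \<omega>))}"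
  proof (rule emeasure_mono_AE)
    show "AE \<omega> in M. \<omega> \<in> {\<omega> \<in> space M. x \<le> stick_breaking (\<lambda>i. U i \<omega>) k} \<longrightarrow>
        \<omega> \<in> {\<omega> \<in> space M. 1 \<le> ennreal (1 / x) * (\<Prod>j\<le>k. Y j (U j \<omega>))}"
      using AE_U_in_unit_interval
    proof eventually_elim
      case (elim \<omega>)
      have "1 \<le> ennreal (1 / x) * (\<Prod>j\<le>k. Y j (U j \<omega>))"
        if ge: "x \<le> stick_breaking (\<lambda>i. U i \<omega>) k"
      proof -
        have le: "x \<le> U k \<omega>" "x \<le> (\<Prod>j<k. 1 - U j \<omega>)"
          using stick_breaking_le_factors[of "\<lambda>i. U i \<omega>" k] elim ge by auto
        have "(\<Prod>j\<le>k. Y j (U j \<omega>)) = (\<Prod>j<k. ennreal (1 - U j \<omega>))"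
          using le by (simp add: lessThan_Suc_atMost[symmetric] Y_def)
        also have "\<dots> = ennreal (\<Prod>j<k. 1 - U j \<omega>)"
          using elim by (intro prod_ennreal) (simp add: less_imp_le)
        finally have "ennreal (1 / x) * (\<Prod>j\<le>k. Y j (U j \<omega>)) = ennreal (1 / x * (\<Prod>j<k. 1 - U j \<omega>))"
          using assms le by (simp add: ennreal_mult[symmetric])
        then show ?thesis
          using assms le by (simp add: field_simps)
      qed
      then show ?case by auto
    qed
  qed measurable
  also have "\<dots> \<le> ennreal (1 / x) * (\<integral>\<^sup>+\<omega>. (\<Prod>j\<le>k. Y j (U j \<omega>)) * indicator (space M) \<omega> \<partial>M)"
    by (rule nn_integral_Markov_inequality) auto
  also have "(\<integral>\<^sup>+\<omega>. (\<Prod>j\<le>k. Y j (U j \<omega>)) * indicator (space M) \<omega> \<partial>M)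
      = (\<integral>\<^sup>+\<omega>. (\<Prod>j\<le>k. Y j (U j \<omega>)) \<partial>M)"
    by (intro nn_integral_cong) simp
  also have "\<dots> = (\<Prod>j\<le>k. \<integral>\<^sup>+\<omega>. Y j (U j \<omega>) \<partial>M)"
    by (intro indep_vars_nn_integral indep_vars_compose2[OF indep_vars_subset[OF indep_U]]) auto
  also have "\<dots> = ennreal ((\<theta> / (\<theta> + 1)) ^ k) * ennreal ((1 - x) powr \<theta>)"
    using assms theta_pos
    by (simp add: lessThan_Suc_atMost[symmetric] Y_def nn_integral_one_minus_U nn_integral_U_ge
        ennreal_power)
  also have "ennreal (1 / x) * \<dots> = ennreal ((1 - x) powr \<theta> / x * (\<theta> / (\<theta> + 1)) ^ k)"
    using assms theta_pos by (simp add: ennreal_mult[symmetric] field_simps)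
  finally show ?thesis
    using assms theta_pos by (simp add: emeasure_eq_measure)
qed

lemma prob_P1_ge_upper:
  assumes "0 < x" "x \<le> 1"
  shows "prob {\<omega> \<in> space M. x \<le> P1 \<omega>} \<le> (\<theta> + 1) / x * (1 - x) powr \<theta>"
proof -
  define A where "A k = {\<omega> \<in> space M. x \<le> stick_breaking (\<lambda>i. U i \<omega>) k}" for k
  have [measurable]: "A k \<in> sets M" for k
    unfolding A_def stick_breaking_def by measurable
  have "(\<lambda>k. (1 - x) powr \<theta> / x * (\<theta> / (\<theta> + 1)) ^ k) sums
      ((1 - x) powr \<theta> / x * (1 / (1 - \<theta> / (\<theta> + 1))))"
    using theta_pos by (intro sums_mult geometric_sums) auto
  also have "(1 - x) powr \<theta> / x * (1 / (1 - \<theta> / (\<theta> + 1))) = (\<theta> + 1) / x * (1 - x) powr \<theta>"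
    using theta_pos by (simp add: field_simps)
  finally have geo: "(\<lambda>k. (1 - x) powr \<theta> / x * (\<theta> / (\<theta> + 1)) ^ k) sums
      ((\<theta> + 1) / x * (1 - x) powr \<theta>)" .
  have le: "prob (A k) \<le> (1 - x) powr \<theta> / x * (\<theta> / (\<theta> + 1)) ^ k" for k
    unfolding A_def by (rule prob_stick_ge[OF assms])
  have summable: "summable (\<lambda>k. prob (A k))"
    by (rule summable_comparison_test'[OF sums_summable[OF geo], of 0]) (use le in simp)
  have "prob {\<omega> \<in> space M. x \<le> P1 \<omega>} \<le> prob (\<Union>k. A k)"
  proof (rule finite_measure_mono_AE)
    show "AE \<omega> in M. \<omega> \<in> {\<omega> \<in> space M. x \<le> P1 \<omega>} \<longrightarrow> \<omega> \<in> (\<Union>k. A k)"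
      using AE_U_in_unit_interval
    proof eventually_elim
      case (elim \<omega>)
      obtain n where "P1 \<omega> = stick_breaking (\<lambda>i. U i \<omega>) n"
        unfolding PD_component_def using largest_stick[of "\<lambda>i. U i \<omega>"] elim by metis
      then show ?case by (auto simp: A_def)
    qed
  qed simp
  also have "\<dots> \<le> (\<Sum>k. prob (A k))"
    by (rule finite_measure_subadditive_countably[OF _ summable]) auto
  also have "\<dots> \<le> (\<theta> + 1) / x * (1 - x) powr \<theta>"
    unfolding sums_unique[OF geo] by (rule suminf_le[OF le summable sums_summable[OF geo]])
  finally show ?thesis .
qed

lemma AE_U0_le_P1_less_1: "AE \<omega> in M. 0 < U 0 \<omega> \<and> U 0 \<omega> \<le> P1 \<omega> \<and> P1 \<omega> < 1"
  using AE_U_in_unit_interval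
proof eventually_elim
  case (elim \<omega>)
  obtain n where n: "P1 \<omega> = stick_breaking (\<lambda>i. U i \<omega>) n"
    and max: "\<And>i. stick_breaking (\<lambda>i. U i \<omega>) i \<le> P1 \<omega>"
    unfolding PD_component_def using largest_stick[of "\<lambda>i. U i \<omega>"] elim by metis
  have "P1 \<omega> \<le> U n \<omega>"
    unfolding n by (rule stick_breaking_le_factors) (use elim in auto)
  with max[of 0] elim show ?case
    by (auto simp: stick_breaking_def intro: le_less_trans)
qed

lemma prob_P1_ge_lower:
  assumes "0 \<le> x" "x \<le> 1"
  shows "(1 - x) powr \<theta> \<le> prob {\<omega> \<in> space M. x \<le> P1 \<omega>}"
proof -
  have "prob {\<omega> \<in> space M. x \<le> U 0 \<omega>} \<le> prob {\<omega> \<in> space M. x \<le> P1 \<omega>}"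
  proof (rule finite_measure_mono_AE)
    show "AE \<omega> in M. \<omega> \<in> {\<omega> \<in> space M. x \<le> U 0 \<omega>} \<longrightarrow> \<omega> \<in> {\<omega> \<in> space M. x \<le> P1 \<omega>}"
      using AE_U0_le_P1_less_1 by eventually_elim auto
  qed measurable
  then show ?thesis by (simp add: prob_U_ge[OF assms])
qed

text \<open>
  Subtracting tails avoids any lower estimate for the event that all later sticks stay small.
\<close>

lemma prob_P1_in_interval:
  assumes "0 \<le> a" "a < b" "b \<le> 1"
  shows "(1 - a) powr \<theta> - (\<theta> + 1) / b * (1 - b) powr \<theta>
           \<le> prob {\<omega> \<in> space M. P1 \<omega> \<in> {a..<b}}"
proof -
  have "prob ({\<omega> \<in> space M. a \<le> P1 \<omega>} - {\<omega> \<in> space M. b \<le> P1 \<omega>}) =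
      prob {\<omega> \<in> space M. a \<le> P1 \<omega>} - prob {\<omega> \<in> space M. b \<le> P1 \<omega>}"
    using assms by (intro finite_measure_Diff) auto
  also have "{\<omega> \<in> space M. a \<le> P1 \<omega>} - {\<omega> \<in> space M. b \<le> P1 \<omega>} =
      {\<omega> \<in> space M. P1 \<omega> \<in> {a..<b}}"
    by auto
  finally have "prob {\<omega> \<in> space M. P1 \<omega> \<in> {a..<b}} =
      prob {\<omega> \<in> space M. a \<le> P1 \<omega>} - prob {\<omega> \<in> space M. b \<le> P1 \<omega>}" .
  then show ?thesis
    using prob_P1_ge_lower[of a] prob_P1_ge_upper[of b] assms by auto
qed

abbreviation "Q \<equiv> law_on_unit_interval M P1"

lemma sets_law: "sets Q = sets (restrict_space borel {0..1})"
  unfolding law_on_unit_interval_def by (rule sets_restrict_space_cong) simp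

lemma prob_space_law: "prob_space Q"
  unfolding law_on_unit_interval_def
proof (rule prob_space_restrict_space)
  have "AE \<omega> in M. P1 \<omega> \<in> {0..1}"
    using AE_U0_le_P1_less_1 by eventually_elim auto
  then have "prob {\<omega> \<in> space M. P1 \<omega> \<in> {0..1}} = 1"
    by (subst prob_Collect_eq_1) auto
  moreover have "P1 -` {0..1} \<inter> space M = {\<omega> \<in> space M. P1 \<omega> \<in> {0..1}}" by auto
  ultimately show "emeasure (distr M borel P1) {0..1} = 1"
    by (simp add: emeasure_distr emeasure_eq_measure)
qed simp

lemma measure_law:
  assumes "S \<in> sets borel" "S \<subseteq> {0..1}"
  shows "measure Q S = prob {\<omega> \<in> space M. P1 \<omega> \<in> S}"
proof -
  have "measure Q S = measure (distr M borel P1) S"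
    unfolding law_on_unit_interval_def using assms by (intro measure_restrict_space) auto
  also have "\<dots> = prob {\<omega> \<in> space M. P1 \<omega> \<in> S}"
    using assms by (subst measure_distr) (auto intro!: arg_cong[where f = prob])
  finally show ?thesis .
qed

lemma measure_law_le:
  assumes "S \<in> sets borel" "S \<subseteq> {x..1}" "0 < x" "x \<le> 1"
  shows "measure Q S \<le> (\<theta> + 1) / x * (1 - x) powr \<theta>"
proof -
  have "measure Q S = prob {\<omega> \<in> space M. P1 \<omega> \<in> S}"
    using assms by (intro measure_law) auto
  also have "\<dots> \<le> prob {\<omega> \<in> space M. x \<le> P1 \<omega>}"
    using assms by (intro finite_measure_mono) auto
  also have "\<dots> \<le> (\<theta> + 1) / x * (1 - x) powr \<theta>"
    by (rule prob_P1_ge_upper) fact+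
  finally show ?thesis .
qed

lemma measure_law_ge:
  assumes "S \<in> sets borel" "{a..<b} \<subseteq> S" "S \<subseteq> {0..1}" "0 \<le> a" "a < b" "b \<le> 1"
  shows "(1 - a) powr \<theta> - (\<theta> + 1) / b * (1 - b) powr \<theta> \<le> measure Q S"
proof -
  have "(1 - a) powr \<theta> - (\<theta> + 1) / b * (1 - b) powr \<theta> \<le> prob {\<omega> \<in> space M. P1 \<omega> \<in> {a..<b}}"
    by (rule prob_P1_in_interval) fact+
  also have "\<dots> \<le> prob {\<omega> \<in> space M. P1 \<omega> \<in> S}"
    using assms(1,2) by (intro finite_measure_mono) auto
  finally show ?thesis using measure_law[OF assms(1,3)] by simp
qed

end

section \<open>Exponential rates\<close>

lemma log_ereal_mono: "0 \<le> p \<Longrightarrow> p \<le> q \<Longrightarrow> log_ereal p \<le> log_ereal q"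
  by (auto simp: log_ereal_def)

lemma scaled_log_ereal_mono:
  assumes "0 < \<theta>" "0 \<le> p" "p \<le> q"
  shows "ereal (1 / \<theta>) * log_ereal p \<le> ereal (1 / \<theta>) * log_ereal q"
  using assms by (intro ereal_mult_left_mono log_ereal_mono) auto

lemma scaled_log_ereal_pos: "0 < p \<Longrightarrow> ereal (1 / \<theta>) * log_ereal p = ereal (ln p / \<theta>)"
  by (simp add: log_ereal_def)

lemma Limsup_scaled_log_le:
  assumes "eventually (\<lambda>\<theta>. 0 \<le> q \<theta> \<and> q \<theta> \<le> b \<theta> \<and> 0 < b \<theta>) at_top"
    and "((\<lambda>\<theta>. ln (b \<theta>) / \<theta>) \<longlongrightarrow> L) at_top"
  shows "Limsup at_top (\<lambda>\<theta>. ereal (1 / \<theta>) * log_ereal (q \<theta>)) \<le> ereal L"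
proof -
  have "Limsup at_top (\<lambda>\<theta>. ereal (1 / \<theta>) * log_ereal (q \<theta>)) \<le> Limsup at_top (\<lambda>\<theta>. ereal (ln (b \<theta>) / \<theta>))"
  proof (rule Limsup_mono)
    show "eventually (\<lambda>\<theta>. ereal (1 / \<theta>) * log_ereal (q \<theta>) \<le> ereal (ln (b \<theta>) / \<theta>)) at_top"
      using assms(1) eventually_gt_at_top[of 0]
      by eventually_elim (metis scaled_log_ereal_mono scaled_log_ereal_pos)
  qed
  also have "\<dots> = ereal L"
    using assms(2) by (intro lim_imp_Limsup tendsto_ereal) auto
  finally show ?thesis .
qed

lemma Liminf_scaled_log_ge:
  assumes "eventually (\<lambda>\<theta>. b \<theta> \<le> q \<theta> \<and> 0 < b \<theta>) at_top"
    and "((\<lambda>\<theta>. ln (b \<theta>) / \<theta>) \<longlongrightarrow> L) at_top"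
  shows "ereal L \<le> Liminf at_top (\<lambda>\<theta>. ereal (1 / \<theta>) * log_ereal (q \<theta>))"
proof -
  have "ereal L = Liminf at_top (\<lambda>\<theta>. ereal (ln (b \<theta>) / \<theta>))"
    using assms(2) by (intro lim_imp_Liminf[symmetric] tendsto_ereal) auto
  also have "\<dots> \<le> Liminf at_top (\<lambda>\<theta>. ereal (1 / \<theta>) * log_ereal (q \<theta>))"
  proof (rule Liminf_mono)
    show "eventually (\<lambda>\<theta>. ereal (ln (b \<theta>) / \<theta>) \<le> ereal (1 / \<theta>) * log_ereal (q \<theta>)) at_top"
      using assms(1) eventually_gt_at_top[of 0]
      by eventually_elim (metis less_imp_le scaled_log_ereal_mono scaled_log_ereal_pos)
  qed
  finally show ?thesis .
qed

lemma Limsup_scaled_log_of_zero: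
  assumes "eventually (\<lambda>\<theta>. q \<theta> = 0) at_top"
  shows "Limsup at_top (\<lambda>\<theta>. ereal (1 / \<theta>) * log_ereal (q \<theta>)) = - \<infinity>"
proof -
  have "eventually (\<lambda>\<theta>. ereal (1 / \<theta>) * log_ereal (q \<theta>) \<le> - \<infinity>) at_top"
    using assms eventually_gt_at_top[of 0] by eventually_elim (auto simp: log_ereal_def)
  then have "Limsup at_top (\<lambda>\<theta>. ereal (1 / \<theta>) * log_ereal (q \<theta>)) \<le> - \<infinity>"
    by (rule Limsup_bounded)
  then show ?thesis by simp
qed

text \<open>
  The factor \<open>\<theta> + 1\<close> that the union bound costs disappears on the exponential scale.
\<close>

lemma ln_tail_over_theta_tendsto:
  fixes c y :: real
  assumes "c > 0" "y > 0"
  shows "((\<lambda>\<theta>. ln ((\<theta> + 1) * c * y powr \<theta>) / \<theta>) \<longlongrightarrow> ln y) at_top"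
proof -
  have "((\<lambda>\<theta>. ln (\<theta> + 1) / \<theta> + ln c / \<theta> + ln y) \<longlongrightarrow> ln y) at_top"
    by real_asymp
  moreover have "eventually (\<lambda>\<theta>. ln (\<theta> + 1) / \<theta> + ln c / \<theta> + ln y = ln ((\<theta> + 1) * c * y powr \<theta>) / \<theta>) at_top"
    using eventually_gt_at_top[of 0]
  proof eventually_elim
    case (elim \<theta>)
    then have "ln ((\<theta> + 1) * c * y powr \<theta>) = ln (\<theta> + 1) + ln c + \<theta> * ln y"
      using assms by (simp add: ln_mult)
    with elim show ?case by (simp add: add_divide_distrib)
  qed
  ultimately show ?thesis by (rule Lim_transform_eventually)
qed

lemma ln_half_powr_over_theta_tendsto:
  fixes y :: real
  assumes "y > 0"
  shows "((\<lambda>\<theta>. ln (y powr \<theta> / 2) / \<theta>) \<longlongrightarrow> ln y) at_top"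
proof -
  have "((\<lambda>\<theta>. ln y - ln 2 / \<theta>) \<longlongrightarrow> ln y) at_top"
    by real_asymp
  moreover have "eventually (\<lambda>\<theta>. ln y - ln 2 / \<theta> = ln (y powr \<theta> / 2) / \<theta>) at_top"
    using eventually_gt_at_top[of 0]
    by eventually_elim (use assms in \<open>simp add: ln_div ln_powr field_simps\<close>)
  ultimately show ?thesis by (rule Lim_transform_eventually)
qed

lemma tail_eventually_dominated:
  fixes c y z :: real
  assumes "0 \<le> z" "z < y" "c > 0"
  shows "eventually (\<lambda>\<theta>. (\<theta> + 1) * c * z powr \<theta> \<le> y powr \<theta> / 2) at_top"
proof (cases "z = 0")
  case False
  define r where "r = z / y"
  have r: "0 < r" "r < 1"
    using assms False by (auto simp: r_def)
  have "((\<lambda>\<theta>. (\<theta> + 1) * c * r powr \<theta>) \<longlongrightarrow> 0) at_top"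
    using r by real_asymp
  then have "eventually (\<lambda>\<theta>. (\<theta> + 1) * c * r powr \<theta> < 1 / 2) at_top"
    by (rule order_tendstoD) simp
  then show ?thesis
    by eventually_elim (use assms in \<open>simp add: r_def powr_divide field_simps\<close>)
qed simp

section \<open>The rate function\<close>

definition rate :: "real \<Rightarrow> ereal" where
  "rate x = (if x \<in> {0..<1} then ereal (ln (1 / (1 - x))) else \<infinity>)"

lemma rate_eq: "0 \<le> x \<Longrightarrow> x < 1 \<Longrightarrow> rate x = ereal (- ln (1 - x))"
  by (simp add: rate_def ln_div)

lemma rate_nonneg: "0 \<le> rate x"
  by (simp add: rate_def)

lemma rate_mono: "0 \<le> x \<Longrightarrow> x \<le> y \<Longrightarrow> rate x \<le> rate y"
  by (auto simp: rate_def ln_div)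

lemma rate_sublevel: "{x \<in> {0..1}. rate x \<le> ereal c} = {0..1 - exp (- c)}"
proof (intro equalityI subsetI)
  fix x assume x: "x \<in> {x \<in> {0..1}. rate x \<le> ereal c}"
  then have "0 \<le> x" "x < 1" "- ln (1 - x) \<le> c"
    by (auto simp: rate_def ln_div split: if_splits)
  then show "x \<in> {0..1 - exp (- c)}"
    using ln_ge_iff[of "1 - x" "- c"] by simp
next
  fix x assume x: "x \<in> {0..1 - exp (- c)}"
  have "0 < exp (- c)" by simp
  with x have "x < 1" unfolding atLeastAtMost_iff by linarith
  then show "x \<in> {x \<in> {0..1}. rate x \<le> ereal c}"
    using x ln_ge_iff[of "1 - x" "- c"] by (simp add: rate_eq)
qed

section \<open>The large deviation principle\<close>

theorem lemma4p2:
  fixes M :: "real \<Rightarrow> 'w measure" and U :: "real \<Rightarrow> nat \<Rightarrow> 'w \<Rightarrow> real"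
  assumes "\<And>\<theta>. \<theta> > 0 \<Longrightarrow> prob_space (M \<theta>)"
    and "\<And>\<theta>. \<theta> > 0 \<Longrightarrow> prob_space.indep_vars (M \<theta>) (\<lambda>_. borel) (U \<theta>) UNIV"
    and "\<And>\<theta> i. \<theta> > 0 \<Longrightarrow>
           distributed (M \<theta>) lborel (U \<theta> i) (\<lambda>x. ennreal (beta_1_density \<theta> x))"
  shows "satisfies_LDP {0..1}
           (\<lambda>\<theta>. law_on_unit_interval (M \<theta>) (PD_component (U \<theta>) 1))
           (\<lambda>x. if x \<in> {0..<1} then ereal (ln (1 / (1 - x))) else \<infinity>)"
proof -
  define Q where "Q \<theta> = law_on_unit_interval (M \<theta>) (PD_component (U \<theta>) 1)" for \<theta>
  have beta: "iid_beta (M \<theta>) \<theta> (U \<theta>)" if "\<theta> > 0" for \<theta>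
    using that assms by (auto simp: iid_beta_def iid_beta_axioms_def)
  note prob_space_Q = iid_beta.prob_space_law[OF beta, folded Q_def]
  note sets_Q = iid_beta.sets_law[OF beta, folded Q_def]
  note Q_le = iid_beta.measure_law_le[OF beta, folded Q_def]
  note Q_ge = iid_beta.measure_law_ge[OF beta, folded Q_def]

  have upper: "Limsup at_top (\<lambda>\<theta>. ereal (1 / \<theta>) * log_ereal (measure (Q \<theta>) F)) \<le> - (INF x\<in>F. rate x)"
    if F: "closedin (top_of_set {0..1}) F" for F
  proof (cases "F = {}")
    case True
    then show ?thesis
      by (simp add: Limsup_scaled_log_of_zero top_ereal_def)
  next
    case False
    have "compact F" "F \<subseteq> {0..1}"
      using closedin_compact[OF _ F] closedin_imp_subset[OF F] by auto
    then obtain m where m: "m \<in> F" "\<And>x. x \<in> F \<Longrightarrow> m \<le> x"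
      using compact_attains_inf[of F] False by blast
    have m01: "0 \<le> m" "m \<le> 1" and sub: "F \<subseteq> {m..1}" and borel: "F \<in> sets borel"
      using m \<open>F \<subseteq> {0..1}\<close> \<open>compact F\<close> by (auto simp: compact_imp_closed)
    have "(INF x\<in>F. rate x) = rate m"
      using m m01 by (intro antisym INF_lower INF_greatest rate_mono) auto
    moreover have "Limsup at_top (\<lambda>\<theta>. ereal (1 / \<theta>) * log_ereal (measure (Q \<theta>) F)) \<le> - rate m"
    proof -
      consider "m = 0" | "0 < m" "m < 1" | "m = 1"
        using m01 by linarith
      then show ?thesis
      proof cases
        \<comment> \<open>The tail bound blows up at \<open>0\<close>, but there the rate is \<open>0\<close> and any probability bound will do.\<close>
        case 1
        have "Limsup at_top (\<lambda>\<theta>. ereal (1 / \<theta>) * log_ereal (measure (Q \<theta>) F)) \<le> ereal 0"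
        proof (rule Limsup_scaled_log_le[where b = "\<lambda>_. 1"])
          show "eventually (\<lambda>\<theta>. 0 \<le> measure (Q \<theta>) F \<and> measure (Q \<theta>) F \<le> 1 \<and> 0 < (1::real)) at_top"
            using eventually_gt_at_top[of 0]
            by eventually_elim (auto intro: prob_space.prob_le_1 prob_space_Q)
        qed simp
        with 1 show ?thesis by (simp add: rate_eq)
      next
        case 2
        have "Limsup at_top (\<lambda>\<theta>. ereal (1 / \<theta>) * log_ereal (measure (Q \<theta>) F)) \<le> ereal (ln (1 - m))"
        proof (rule Limsup_scaled_log_le)
          show "eventually (\<lambda>\<theta>. 0 \<le> measure (Q \<theta>) F \<and>
              measure (Q \<theta>) F \<le> (\<theta> + 1) * (1 / m) * (1 - m) powr \<theta> \<and>
              0 < (\<theta> + 1) * (1 / m) * (1 - m) powr \<theta>) at_top"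
            using eventually_gt_at_top[of 0]
          proof eventually_elim
            case (elim \<theta>)
            then show ?case using Q_le[OF elim borel sub] 2 by simp
          qed
          show "((\<lambda>\<theta>. ln ((\<theta> + 1) * (1 / m) * (1 - m) powr \<theta>) / \<theta>) \<longlongrightarrow> ln (1 - m)) at_top"
            using 2 by (intro ln_tail_over_theta_tendsto) auto
        qed
        with 2 show ?thesis by (simp add: rate_eq)
      next
        \<comment> \<open>The tail bound at \<open>1\<close> is \<open>0\<close>, which matches the infinite rate.\<close>
        case 3
        have "eventually (\<lambda>\<theta>. measure (Q \<theta>) F = 0) at_top"
          using eventually_gt_at_top[of 0]
        proof eventually_elim
          case (elim \<theta>)
          show ?case
            using Q_le[OF elim borel sub] 3 by (simp add: measure_le_0_iff)
        qed
        then show ?thesis by (simp add: Limsup_scaled_log_of_zero)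
      qed
    qed
    ultimately show ?thesis by simp
  qed

  have lower: "- (INF x\<in>G. rate x) \<le> Liminf at_top (\<lambda>\<theta>. ereal (1 / \<theta>) * log_ereal (measure (Q \<theta>) G))"
    (is "_ \<le> ?L") if G: "openin (top_of_set {0..1}) G" for G
  proof -
    obtain T where T: "open T" "G = {0..1} \<inter> T"
      using G by (auto simp: openin_open)
    then have borel: "G \<in> sets borel" and sub: "G \<subseteq> {0..1}" by auto
    have "- ?L \<le> rate x" if x: "x \<in> G" for x
    proof (cases "x < 1")
      case False
      then show ?thesis by (simp add: rate_def)
    next
      case True
      have "0 \<le> x" using x sub by auto
      obtain e where e: "e > 0" "\<And>y. dist y x < e \<Longrightarrow> y \<in> T"
        using T x by (auto simp: open_dist)
      define b where "b = min 1 (x + e)"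
      have b: "x < b" "b \<le> 1" "{x..<b} \<subseteq> G"
        using e True \<open>0 \<le> x\<close> by (auto simp: b_def T dist_real_def)
      \<comment> \<open>The subtracted tail at \<open>b\<close> eventually costs at most half of the main term.\<close>
      have "ereal (ln (1 - x)) \<le> ?L"
      proof (rule Liminf_scaled_log_ge)
        have "eventually (\<lambda>\<theta>. (\<theta> + 1) * (1 / b) * (1 - b) powr \<theta> \<le> (1 - x) powr \<theta> / 2) at_top"
          using b \<open>0 \<le> x\<close> by (intro tail_eventually_dominated) auto
        then show "eventually (\<lambda>\<theta>. (1 - x) powr \<theta> / 2 \<le> measure (Q \<theta>) G \<and> 0 < (1 - x) powr \<theta> / 2) at_top"
          using eventually_gt_at_top[of 0]
        proof eventually_elim
          case (elim \<theta>)
          then show ?case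
            using Q_ge[OF elim(2) borel b(3) sub \<open>0 \<le> x\<close> b(1,2)] True by simp
        qed
        show "((\<lambda>\<theta>. ln ((1 - x) powr \<theta> / 2) / \<theta>) \<longlongrightarrow> ln (1 - x)) at_top"
          using True by (intro ln_half_powr_over_theta_tendsto) auto
      qed
      then show ?thesis
        using True \<open>0 \<le> x\<close> by (simp add: rate_eq ereal_uminus_le_reorder)
    qed
    then have "- ?L \<le> (INF x\<in>G. rate x)"
      by (rule INF_greatest)
    then show ?thesis by (simp add: ereal_uminus_le_reorder)
  qed

  have "satisfies_LDP {0..1} Q rate"
    unfolding satisfies_LDP_def
    using prob_space_Q sets_Q upper lower rate_nonneg rate_sublevel
    by (auto simp: compact_imp_complete)
  then show ?thesis
    unfolding Q_def rate_def .
qed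

end
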